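(* Let $M_1$ and $M_2$ be matroids of ranks $r_1$ and $r_2$ on ground sets $E_1$ and $E_2$ respectively, where $E_1\cap E_2=\emptyset$. Then $P(M_1\oplus M_2)$ admits a sequence of hyperplane splits if either $P(M_1)$ or $P(M_2)$ admits a sequence of hyperplane splits.
   Context: For a matroid $M$ on a finite set $E$ with set of bases $\mathcal{B}(M)$, the matroid base polytope is $P(M)=\mathrm{conv}\{\sum_{i\in B}e_i : B\in\mathcal{B}(M)\}\subset\mathbb{R}^{E}$, where $e_i$ is the standard basis vector indexed by $i$. The direct sum $M_1\oplus M_2$ has ground set $E_1\cup E_2$ and bases $\{B_1\cup B_2 : B_1\in\mathcal{B}(M_1), B_2\in\mathcal{B}(M_2)\}$. Matroid base polytope decomposition: an expression $P(M)=\bigcup_{i=1}^t P(M_i)$ where each $P(M_i)$ is the base polytope of a matroid $M_i$ on $E$, each $P(M_i)$ has the same dimension as $P(M)$, and for all $i\ne j$ the intersection $P(M_i)\cap P(M_j)$ is a face of both $P(M_i)$ and $P(M_j)$. A hyperplane split is such a decomposition with $t=2$. Sequence of $s$ hyperplane splits of $P(M)$: hyperplane splits $P(M)=P(N_1)\cup P(N_1')$, $P(N_1')=P(N_2)\cup P(N_2')$, $\dots$, $P(N_{s-1}')=P(N_s)\cup P(N_s')$ such that $P(M)=P(N_1)\cup\cdots\cup P(N_s)\cup P(N_s')$ is a matroid base polytope decomposition of $P(M)$. $P(M)$ admits a sequence of hyperplane splits if it admits a sequence of $s$ hyperplane splits for some $s\ge 2$. *)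

theory Defs
  imports "HOL-Analysis.Analysis"
begin

record 'a basis_system =
  ground :: "'a set"
  bases :: "'a set set"

definition matroid :: "'a basis_system \<Rightarrow> bool" where
  "matroid M \<longleftrightarrow>
     finite (ground M) \<and>
     (\<forall>B\<in>bases M. B \<subseteq> ground M) \<and>
     bases M \<noteq> {} \<and>
     (\<forall>A\<in>bases M. \<forall>B\<in>bases M. \<forall>x\<in>A - B. \<exists>y\<in>B - A. insert y (A - {x}) \<in> bases M)"

definition matroid_rank :: "'a basis_system \<Rightarrow> nat" where
  "matroid_rank M = card (SOME B. B \<in> bases M)"

definition direct_sum :: "'a basis_system \<Rightarrow> 'a basis_system \<Rightarrow> 'a basis_system" where
  "direct_sum M1 M2 =
     \<lparr>ground = ground M1 \<union> ground M2,
      bases = {B1 \<union> B2 |B1 B2. B1 \<in> bases M1 \<and> B2 \<in> bases M2}\<rparr>"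

text \<open>
  The space of real vectors indexed by the ground set is the coordinate subspace of
  \<^typ>\<open>real^'a\<close> of the vectors that vanish outside the ground set. Convexity, faces and
  dimension do not depend on the ambient space.
\<close>

definition base_polytope :: "('a::finite) basis_system \<Rightarrow> (real^'a) set" where
  "base_polytope M = convex hull ((\<lambda>B. \<Sum>i\<in>B. axis i 1) ` bases M)"

text \<open>
  The relation \<^const>\<open>face_of\<close> counts a polytope as a face of itself, so repeated pieces have to
  be excluded: otherwise every polytope would split into two copies of itself. Since the pieces
  have equal dimension, distinctness says exactly that the common faces are proper.
  The empty set counts as a face, so two pieces may be disjoint.
\<close>

definition base_polytope_decomposition ::
    "('a::finite) basis_system \<Rightarrow> 'a basis_system list \<Rightarrow> bool" where
  "base_polytope_decomposition M Ns \<longleftrightarrow>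
     (\<forall>N\<in>set Ns. matroid N \<and> ground N = ground M \<and>
        aff_dim (base_polytope N) = aff_dim (base_polytope M)) \<and>
     base_polytope M = (\<Union>N\<in>set Ns. base_polytope N) \<and>
     (\<forall>i<length Ns. \<forall>j<length Ns. i \<noteq> j \<longrightarrow>
        base_polytope (Ns ! i) \<noteq> base_polytope (Ns ! j) \<and>
        (base_polytope (Ns ! i) \<inter> base_polytope (Ns ! j)) face_of base_polytope (Ns ! i) \<and>
        (base_polytope (Ns ! i) \<inter> base_polytope (Ns ! j)) face_of base_polytope (Ns ! j))"

definition hyperplane_split ::
    "('a::finite) basis_system \<Rightarrow> 'a basis_system \<Rightarrow> 'a basis_system \<Rightarrow> bool" where
  "hyperplane_split M N N' \<longleftrightarrow> base_polytope_decomposition M [N, N']"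

text \<open>The matroids produced by the splits are \<open>N 1, \<dots>, N s\<close> and \<open>N' 1, \<dots>, N' s\<close>; the values
  of \<open>N\<close> and \<open>N'\<close> at other indices are irrelevant.\<close>

definition hyperplane_split_sequence ::
    "nat \<Rightarrow> ('a::finite) basis_system \<Rightarrow> (nat \<Rightarrow> 'a basis_system) \<Rightarrow> (nat \<Rightarrow> 'a basis_system) \<Rightarrow> bool"
  where
  "hyperplane_split_sequence s M N N' \<longleftrightarrow>
     hyperplane_split M (N 1) (N' 1) \<and>
     (\<forall>k\<in>{1..<s}. hyperplane_split (N' k) (N (k + 1)) (N' (k + 1))) \<and>
     base_polytope_decomposition M (map N [1..<s + 1] @ [N' s])"

definition admits_hyperplane_split_sequence :: "('a::finite) basis_system \<Rightarrow> bool" where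
  "admits_hyperplane_split_sequence M \<longleftrightarrow>
     (\<exists>s\<ge>2. \<exists>N N'. hyperplane_split_sequence s M N N')"

lemma matroid_exchange:
  assumes "matroid M" "A \<in> bases M" "B \<in> bases M" "x \<in> A" "x \<notin> B"
  shows "\<exists>y. y \<in> B \<and> y \<notin> A \<and> insert y (A - {x}) \<in> bases M"
proof -
  have "\<forall>A\<in>bases M. \<forall>B\<in>bases M. \<forall>x\<in>A - B. \<exists>y\<in>B - A. insert y (A - {x}) \<in> bases M"
    using assms(1) by (simp add: matroid_def)
  from this[rule_format, of A B x] assms(2-5) show ?thesis by auto
qed

lemma matroid_card_le:
  assumes "matroid M" "A \<in> bases M" "B \<in> bases M"
  shows "card A \<le> card B"
  using assms(2)
proof (induction "card (A - B)" arbitrary: A rule: less_induct)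
  case less
  have fin: "finite X" if "X \<in> bases M" for X
    using assms(1) that finite_subset[of X "ground M"] by (simp add: matroid_def)
  show ?case
  proof (cases "A \<subseteq> B")
    case True
    then show ?thesis using fin assms(3) by (simp add: card_mono)
  next
    case False
    then obtain x where x: "x \<in> A" "x \<notin> B" by blast
    obtain y where y: "y \<in> B" "y \<notin> A" "insert y (A - {x}) \<in> bases M"
      using matroid_exchange[OF assms(1) less.prems assms(3) x] by blast
    have "insert y (A - {x}) - B \<subset> A - B" using x y(1) by auto
    then have "card (insert y (A - {x}) - B) < card (A - B)"
      using fin[OF less.prems] by (intro psubset_card_mono) simp_all
    then have "card (insert y (A - {x})) \<le> card B" by (rule less.hyps[OF _ y(3)])
    moreover have "card (insert y (A - {x})) = card A"
      using fin[OF less.prems] x(1) y(2) by (simp add: card_Suc_Diff1 del: card_Diff_insert card_Diff_singleton)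
    ultimately show ?thesis by simp
  qed
qed

lemma card_basis_eq_rank:
  assumes "matroid M" "B \<in> bases M"
  shows "card B = matroid_rank M"
proof -
  have "(SOME B. B \<in> bases M) \<in> bases M" using assms(2) by (rule someI)
  then show ?thesis unfolding matroid_rank_def
    using matroid_card_le[OF assms(1)] assms(2) by (simp add: order_antisym)
qed

lemma matroid_direct_sum:
  assumes "matroid M1" "matroid M2" "ground M1 \<inter> ground M2 = {}"
  shows "matroid (direct_sum M1 M2)"
proof -
  have sub: "B \<subseteq> ground M1" if "B \<in> bases M1" for B using assms(1) that by (simp add: matroid_def)
  have sub': "B \<subseteq> ground M2" if "B \<in> bases M2" for B using assms(2) that by (simp add: matroid_def)
  have un: "C \<union> D \<in> bases (direct_sum M1 M2)" if "C \<in> bases M1" "D \<in> bases M2" for C D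
    using that by (auto simp: direct_sum_def)
  have "\<exists>y\<in>(B1 \<union> B2) - (A1 \<union> A2). insert y ((A1 \<union> A2) - {x}) \<in> bases (direct_sum M1 M2)"
    if A: "A1 \<in> bases M1" "A2 \<in> bases M2" and B: "B1 \<in> bases M1" "B2 \<in> bases M2"
      and x: "x \<in> (A1 \<union> A2) - (B1 \<union> B2)" for A1 A2 B1 B2 x
  proof (cases "x \<in> A1")
    case True
    obtain y where y: "y \<in> B1" "y \<notin> A1" "insert y (A1 - {x}) \<in> bases M1"
      using matroid_exchange[OF assms(1) A(1) B(1) True] x by blast
    have "x \<notin> A2" "y \<notin> A2"
      using True y sub[OF A(1)] sub[OF B(1)] sub'[OF A(2)] assms(3) by auto
    then have "insert y ((A1 \<union> A2) - {x}) = insert y (A1 - {x}) \<union> A2" by auto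
    then have "insert y ((A1 \<union> A2) - {x}) \<in> bases (direct_sum M1 M2)"
      using un[OF y(3) A(2)] by simp
    then show ?thesis using y(1,2) \<open>y \<notin> A2\<close> by auto
  next
    case False
    then have "x \<in> A2" using x by blast
    then obtain y where y: "y \<in> B2" "y \<notin> A2" "insert y (A2 - {x}) \<in> bases M2"
      using matroid_exchange[OF assms(2) A(2) B(2)] x by blast
    have "y \<notin> A1"
      using y sub[OF A(1)] sub'[OF B(2)] assms(3) by auto
    have "insert y ((A1 \<union> A2) - {x}) = A1 \<union> insert y (A2 - {x})"
      using False by auto
    then have "insert y ((A1 \<union> A2) - {x}) \<in> bases (direct_sum M1 M2)"
      using un[OF A(1) y(3)] by simp
    then show ?thesis using y(1,2) \<open>y \<notin> A1\<close> by auto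
  qed
  note exch = this
  have "\<exists>y\<in>B - A. insert y (A - {x}) \<in> bases (direct_sum M1 M2)"
    if AB: "A \<in> bases (direct_sum M1 M2)" "B \<in> bases (direct_sum M1 M2)" and x: "x \<in> A - B" for A B x
  proof -
    from AB obtain A1 A2 B1 B2 where "A = A1 \<union> A2" "B = B1 \<union> B2"
      "A1 \<in> bases M1" "A2 \<in> bases M2" "B1 \<in> bases M1" "B2 \<in> bases M2"
      by (auto simp: direct_sum_def)
    then show ?thesis using exch[of A1 A2 B1 B2 x] x by simp
  qed
  moreover have "finite (ground (direct_sum M1 M2))" "bases (direct_sum M1 M2) \<noteq> {}"
    using assms(1,2) by (auto simp: matroid_def direct_sum_def)
  moreover have "\<forall>B\<in>bases (direct_sum M1 M2). B \<subseteq> ground (direct_sum M1 M2)"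
    using sub sub' unfolding direct_sum_def by fastforce
  ultimately show ?thesis by (simp add: matroid_def)
qed

end

theory Submission
  imports Defs
begin

text \<open>
  Since \<open>E\<^sub>1\<close> and \<open>E\<^sub>2\<close> are disjoint, the indicator vector of \<open>B\<^sub>1 \<union> B\<^sub>2\<close> is the sum of the indicator
  vectors of \<open>B\<^sub>1\<close> and \<open>B\<^sub>2\<close>, and therefore \<open>P(M\<^sub>1 \<oplus> M\<^sub>2) = P(M\<^sub>1) + P(M\<^sub>2)\<close>, a Minkowski sum
  whose summands lie in the independent coordinate subspaces \<open>\<real>\<^bsup>E\<^sub>1\<^esup>\<close> and \<open>\<real>\<^bsup>E\<^sub>2\<^esup>\<close>
  (\<open>base_polytope_direct_sum\<close>).

  For a fixed nonempty convex set \<open>T\<close> in one of two independent subspaces, the operation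
  \<open>S \<mapsto> S + T\<close> on subsets of the other one behaves like taking the product with \<open>T\<close>: it is
  injective, and it preserves unions, intersections, faces and the equality of dimensions of nested
  sets. These are all the notions that occur in a decomposition, so replacing every piece
  \<open>P(N)\<close> by \<open>P(N \<oplus> K) = P(N) + P(K)\<close> turns a decomposition of \<open>P(L)\<close> into one of \<open>P(L \<oplus> K)\<close>
  (\<open>decomposition_direct_sum\<close>). A sequence of hyperplane splits consists of decompositions, so it
  can be carried over split by split, with the same number of splits. The two cases of the theorem
  are symmetric because \<open>\<oplus>\<close> is commutative.
\<close>

section \<open>Minkowski sums along independent subspaces\<close>

lemma independent_subspaces_add_eq_iff:
  assumes "subspace U" "subspace V" "U \<inter> V = {0}"
    and "u \<in> U" "u' \<in> U" "v \<in> V" "v' \<in> V"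
  shows "u + v = u' + v' \<longleftrightarrow> u = u' \<and> v = v'"
proof
  assume eq: "u + v = u' + v'"
  have "u - u' \<in> U" "v' - v \<in> V"
    using assms by (simp_all add: subspace_diff)
  moreover have diff: "u - u' = v' - v"
    using eq by (metis add_diff_cancel add_diff_cancel_left' diff_add_eq)
  ultimately have "u - u' \<in> U \<inter> V" by (metis IntI)
  then have "u - u' = 0" unfolding assms(3) by (rule singletonD)
  with diff show "u = u' \<and> v = v'" by (metis eq_iff_diff_eq_0)
qed simp

lemma set_plus_Int_independent:
  assumes "subspace U" "subspace V" "U \<inter> V = {0}"
    and "S \<subseteq> U" "S' \<subseteq> U" "T \<subseteq> V"
  shows "(S + T) \<inter> (S' + T) = (S \<inter> S') + T"
proof
  show "(S + T) \<inter> (S' + T) \<subseteq> (S \<inter> S') + T"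
  proof
    fix x assume "x \<in> (S + T) \<inter> (S' + T)"
    then obtain s t s' t' where "x = s + t" "s \<in> S" "t \<in> T" and "x = s' + t'" "s' \<in> S'" "t' \<in> T"
      by (metis IntD1 IntD2 set_plus_elim)
    moreover from this have "s = s'"
      using independent_subspaces_add_eq_iff[OF assms(1-3), of s s' t t'] assms(4-6) by auto
    ultimately show "x \<in> (S \<inter> S') + T" by (auto intro: set_plus_intro)
  qed
qed (auto intro: set_plus_intro elim!: set_plus_elim)

lemma set_plus_right_cancel_independent:
  assumes "subspace U" "subspace V" "U \<inter> V = {0}"
    and "S \<subseteq> U" "S' \<subseteq> U" "T \<subseteq> V" "T \<noteq> {}"
  shows "S + T = S' + T \<longleftrightarrow> S = S'"
proof
  have sub: "A \<subseteq> B" if "A \<subseteq> U" "B \<subseteq> U" "A + T = B + T" for A B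
  proof
    fix a assume a: "a \<in> A"
    obtain t where t: "t \<in> T" using assms(7) by blast
    then have "a + t \<in> B + T" using a that(3) by (metis set_plus_intro)
    then obtain b t' where "a + t = b + t'" "b \<in> B" "t' \<in> T" by (rule set_plus_elim)
    then show "a \<in> B"
      using independent_subspaces_add_eq_iff[OF assms(1-3), of a b t t'] a t that(1,2) assms(6) by auto
  qed
  assume "S + T = S' + T"
  then show "S = S'" using sub[of S S'] sub[of S' S] assms(4,5) by auto
qed simp

text \<open>
  A segment in \<open>S + T\<close> through a point of \<open>F + T\<close> projects to a segment in \<open>S\<close> through a point of
  \<open>F\<close>. Either the projection is a proper segment and the face property of \<open>F\<close> applies, or it
  collapses to that point, and both projected endpoints are this point of \<open>F\<close>.
\<close>

lemma face_of_set_plus_independent: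
  assumes "subspace U" "subspace V" "U \<inter> V = {0}"
    and "S \<subseteq> U" "T \<subseteq> V" "convex T" and F: "F face_of S"
  shows "(F + T) face_of (S + T)"
  unfolding face_of_def
proof (intro conjI ballI impI)
  have FS: "F \<subseteq> S" and "convex F" using F by (auto simp: face_of_def)
  show "F + T \<subseteq> S + T" using FS by (rule set_plus_mono2) simp
  show "convex (F + T)" using \<open>convex F\<close> \<open>convex T\<close> by (rule convex_set_plus)
  fix a b x assume ab: "a \<in> S + T" "b \<in> S + T" and x: "x \<in> F + T" and seg: "x \<in> open_segment a b"
  obtain a1 a2 where a: "a = a1 + a2" "a1 \<in> S" "a2 \<in> T" using ab(1) by (rule set_plus_elim)
  obtain b1 b2 where b: "b = b1 + b2" "b1 \<in> S" "b2 \<in> T" using ab(2) by (rule set_plus_elim)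
  obtain x1 x2 where xx: "x = x1 + x2" "x1 \<in> F" "x2 \<in> T" using x by (rule set_plus_elim)
  obtain l where l: "0 < l" "l < 1" "x = (1 - l) *\<^sub>R a + l *\<^sub>R b"
    using seg by (auto simp: in_segment)
  have "x1 + x2 = ((1 - l) *\<^sub>R a1 + l *\<^sub>R b1) + ((1 - l) *\<^sub>R a2 + l *\<^sub>R b2)"
    using l(3) a(1) b(1) xx(1) by (simp add: algebra_simps)
  moreover have "(1 - l) *\<^sub>R a1 + l *\<^sub>R b1 \<in> U" "(1 - l) *\<^sub>R a2 + l *\<^sub>R b2 \<in> V" "x1 \<in> U" "x2 \<in> V"
    using assms(1,2,4,5) a(2,3) b(2,3) xx(2,3) FS
    by (auto intro!: subspace_add subspace_scale)
  ultimately have x1: "x1 = (1 - l) *\<^sub>R a1 + l *\<^sub>R b1"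
    using independent_subspaces_add_eq_iff[OF assms(1-3)] by blast
  have "a1 \<in> F \<and> b1 \<in> F"
  proof (cases "a1 = b1")
    case True
    then have "x1 = a1" using x1 by (simp add: algebra_simps)
    then show ?thesis using True xx(2) by simp
  next
    case False
    then have "x1 \<in> open_segment a1 b1" using x1 l(1,2) by (auto simp: in_segment)
    then show ?thesis using face_ofD[OF F _ a(2) b(2) xx(2)] by blast
  qed
  then show "a \<in> F + T" "b \<in> F + T" using a b by (auto intro: set_plus_intro)
qed

text \<open>
  A subset of \<open>S\<close> has the dimension of \<open>S\<close> exactly when it has the same affine hull. This avoids a
  formula for the dimension of a sum: each translate \<open>S + t\<close> of the larger set lies in the translated affine
  hull of the smaller one.
\<close>

lemma aff_dim_set_plus_cong:
  fixes S S' T :: "'n::euclidean_space set"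
  assumes "S' \<subseteq> S" "aff_dim S' = aff_dim S"
  shows "aff_dim (S' + T) = aff_dim (S + T)"
proof -
  have hull: "affine hull S' = affine hull S"
    using assms aff_dim_eq_full_gen by blast
  have "S + T \<subseteq> affine hull (S' + T)"
  proof
    fix x assume "x \<in> S + T"
    then obtain s t where x: "x = s + t" "s \<in> S" "t \<in> T" by (rule set_plus_elim)
    have "s \<in> affine hull S'" using hull_inc[OF x(2), of affine] hull by simp
    then have "x \<in> affine hull ((+) t ` S')"
      by (simp add: affine_hull_translation x(1) add.commute[of s])
    moreover have "(+) t ` S' \<subseteq> S' + T"
      using x(3) by (auto simp: add.commute[of t] intro: set_plus_intro)
    ultimately show "x \<in> affine hull (S' + T)" using hull_mono[of _ _ affine] by (metis subsetD)
  qed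
  then have "aff_dim (S + T) \<le> aff_dim (S' + T)"
    using aff_dim_subset aff_dim_affine_hull by metis
  moreover have "aff_dim (S' + T) \<le> aff_dim (S + T)"
    using assms(1) by (intro aff_dim_subset set_plus_mono2) auto
  ultimately show ?thesis by simp
qed

section \<open>The base polytope of a direct sum\<close>

definition coordinate_subspace :: "'a::finite set \<Rightarrow> (real^'a) set" where
  "coordinate_subspace E = {x. \<forall>i. i \<notin> E \<longrightarrow> x $ i = 0}"

lemma subspace_coordinate_subspace: "subspace (coordinate_subspace E)"
  by (simp add: subspace_def coordinate_subspace_def)

lemma coordinate_subspace_Int_disjoint:
  assumes "E \<inter> E' = {}"
  shows "coordinate_subspace E \<inter> coordinate_subspace E' = {0}"
  using assms by (simp add: coordinate_subspace_def vec_eq_iff set_eq_iff) metis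

lemma matroid_bases_subset_ground: "matroid M \<Longrightarrow> B \<in> bases M \<Longrightarrow> B \<subseteq> ground M"
  by (simp add: matroid_def)

lemma base_polytope_subset_coordinate_subspace:
  fixes M :: "'a::finite basis_system"
  assumes "matroid M"
  shows "base_polytope M \<subseteq> coordinate_subspace (ground M)"
  unfolding base_polytope_def
proof (rule hull_minimal)
  have "axis i 1 \<in> coordinate_subspace (ground M)" if "i \<in> ground M" for i :: 'a
    using that by (auto simp: coordinate_subspace_def axis_def)
  then show "(\<lambda>B. \<Sum>i\<in>B. axis i 1) ` bases M \<subseteq> coordinate_subspace (ground M)"
    using matroid_bases_subset_ground[OF assms]
    by (auto intro!: subspace_sum[OF subspace_coordinate_subspace])
qed (simp add: subspace_imp_convex subspace_coordinate_subspace)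

lemma base_polytope_nonempty: "matroid M \<Longrightarrow> base_polytope M \<noteq> {}"
  by (simp add: base_polytope_def matroid_def)

lemma convex_base_polytope: "convex (base_polytope M)"
  by (simp add: base_polytope_def)

lemma base_polytope_direct_sum:
  fixes L K :: "'a::finite basis_system"
  assumes "matroid L" "matroid K" "ground L \<inter> ground K = {}"
  shows "base_polytope (direct_sum L K) = base_polytope L + base_polytope K"
proof -
  let ?ind = "\<lambda>B. \<Sum>i\<in>B. axis i 1 :: real^'a"
  have ind: "?ind (B \<union> C) = ?ind B + ?ind C" if "B \<in> bases L" "C \<in> bases K" for B C
  proof -
    have "B \<inter> C = {}"
      using that assms matroid_bases_subset_ground by blast
    then show ?thesis by (simp add: sum.union_disjoint)
  qed
  have "?ind ` bases (direct_sum L K) = ?ind ` bases L + ?ind ` bases K"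
  proof
    show "?ind ` bases (direct_sum L K) \<subseteq> ?ind ` bases L + ?ind ` bases K"
      by (auto simp: direct_sum_def ind intro!: set_plus_intro)
    show "?ind ` bases L + ?ind ` bases K \<subseteq> ?ind ` bases (direct_sum L K)"
    proof
      fix x assume "x \<in> ?ind ` bases L + ?ind ` bases K"
      then obtain B C where BC: "B \<in> bases L" "C \<in> bases K" "x = ?ind B + ?ind C"
        by (auto elim!: set_plus_elim)
      then have "x = ?ind (B \<union> C)" using ind by simp
      moreover have "B \<union> C \<in> bases (direct_sum L K)" using BC by (auto simp: direct_sum_def)
      ultimately show "x \<in> ?ind ` bases (direct_sum L K)" by blast
    qed
  qed
  then show ?thesis by (simp add: base_polytope_def convex_hull_set_plus)
qed

lemma ground_direct_sum: "ground (direct_sum L K) = ground L \<union> ground K"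
  by (simp add: direct_sum_def)

lemma direct_sum_commute: "direct_sum L K = direct_sum K L"
proof -
  have "{B \<union> C |B C. B \<in> bases L \<and> C \<in> bases K} = {C \<union> B |C B. C \<in> bases K \<and> B \<in> bases L}"
    by (metis (no_types, lifting) Un_commute)
  then show ?thesis by (simp add: direct_sum_def Un_commute)
qed

section \<open>Decompositions of a direct sum\<close>

lemma decomposition_direct_sum:
  fixes L K :: "'a::finite basis_system"
  assumes L: "matroid L" and K: "matroid K" and disj: "ground L \<inter> ground K = {}"
    and dec: "base_polytope_decomposition L Ns"
  shows "base_polytope_decomposition (direct_sum L K) (map (\<lambda>N. direct_sum N K) Ns)"
proof -
  let ?U = "coordinate_subspace (ground L)" and ?V = "coordinate_subspace (ground K)"
  let ?T = "base_polytope K"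
  note indep = subspace_coordinate_subspace[of "ground L"] subspace_coordinate_subspace[of "ground K"]
    coordinate_subspace_Int_disjoint[OF disj]
  have T: "?T \<subseteq> ?V" "convex ?T" "?T \<noteq> {}"
    using base_polytope_subset_coordinate_subspace[OF K] convex_base_polytope
      base_polytope_nonempty[OF K] by auto
  have N: "matroid N" "ground N = ground L" "aff_dim (base_polytope N) = aff_dim (base_polytope L)"
    "base_polytope N \<subseteq> base_polytope L" if "N \<in> set Ns" for N
    using dec that by (auto simp: base_polytope_decomposition_def)
  have NU: "base_polytope N \<subseteq> ?U" if "N \<in> set Ns" for N
    using base_polytope_subset_coordinate_subspace[OF N(1)[OF that]] N(2)[OF that] by simp
  have sum_L: "base_polytope (direct_sum L K) = base_polytope L + ?T"
    using L K disj by (rule base_polytope_direct_sum)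
  have sum_N: "base_polytope (direct_sum N K) = base_polytope N + ?T" if "N \<in> set Ns" for N
    using N(1,2)[OF that] K disj by (simp add: base_polytope_direct_sum)
  have "matroid (direct_sum N K) \<and> ground (direct_sum N K) = ground (direct_sum L K) \<and>
      aff_dim (base_polytope (direct_sum N K)) = aff_dim (base_polytope (direct_sum L K))"
    if "N \<in> set Ns" for N
    using N[OF that] K disj
    by (simp add: matroid_direct_sum ground_direct_sum sum_L sum_N[OF that] aff_dim_set_plus_cong)
  moreover have "base_polytope (direct_sum L K) = (\<Union>N\<in>set Ns. base_polytope (direct_sum N K))"
  proof -
    have "base_polytope L = (\<Union>N\<in>set Ns. base_polytope N)"
      using dec by (simp add: base_polytope_decomposition_def)
    then have "base_polytope L + ?T = (\<Union>N\<in>set Ns. base_polytope N + ?T)"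
      by (auto simp: set_plus_def)
    then show ?thesis by (simp add: sum_L sum_N)
  qed
  moreover have "base_polytope (direct_sum (Ns ! i) K) \<noteq> base_polytope (direct_sum (Ns ! j) K) \<and>
      base_polytope (direct_sum (Ns ! i) K) \<inter> base_polytope (direct_sum (Ns ! j) K)
        face_of base_polytope (direct_sum (Ns ! i) K) \<and>
      base_polytope (direct_sum (Ns ! i) K) \<inter> base_polytope (direct_sum (Ns ! j) K)
        face_of base_polytope (direct_sum (Ns ! j) K)"
    if ij: "i < length Ns" "j < length Ns" "i \<noteq> j" for i j
  proof -
    let ?A = "base_polytope (Ns ! i)" and ?B = "base_polytope (Ns ! j)"
    have AB: "?A \<noteq> ?B" "?A \<inter> ?B face_of ?A" "?A \<inter> ?B face_of ?B"
      using dec ij by (auto simp: base_polytope_decomposition_def)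
    have in_Ns: "Ns ! i \<in> set Ns" "Ns ! j \<in> set Ns" using ij by auto
    note AU = NU[OF in_Ns(1)] and BU = NU[OF in_Ns(2)]
    show ?thesis
      unfolding sum_N[OF in_Ns(1)] sum_N[OF in_Ns(2)] set_plus_Int_independent[OF indep AU BU T(1)]
        set_plus_right_cancel_independent[OF indep AU BU T(1,3)]
      using AB(1) face_of_set_plus_independent[OF indep AU T(1,2) AB(2)]
        face_of_set_plus_independent[OF indep BU T(1,2) AB(3)] by blast
  qed
  ultimately show ?thesis
    by (simp add: base_polytope_decomposition_def)
qed

lemma hyperplane_split_direct_sum:
  assumes "matroid L" "matroid K" "ground L \<inter> ground K = {}" "hyperplane_split L N N'"
  shows "hyperplane_split (direct_sum L K) (direct_sum N K) (direct_sum N' K)"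
  using decomposition_direct_sum[of L K "[N, N']"] assms by (simp add: hyperplane_split_def)

lemma hyperplane_split_right_piece:
  assumes "hyperplane_split L N N'"
  shows "matroid N'" "ground N' = ground L"
  using assms by (auto simp: hyperplane_split_def base_polytope_decomposition_def)

lemma admits_hyperplane_split_sequence_direct_sum:
  fixes L K :: "'a::finite basis_system"
  assumes L: "matroid L" and K: "matroid K" and disj: "ground L \<inter> ground K = {}"
    and seq: "admits_hyperplane_split_sequence L"
  shows "admits_hyperplane_split_sequence (direct_sum L K)"
proof -
  obtain s N N' where s: "s \<ge> 2"
    and first: "hyperplane_split L (N 1) (N' 1)"
    and later: "\<And>k. k \<in> {1..<s} \<Longrightarrow> hyperplane_split (N' k) (N (k + 1)) (N' (k + 1))"
    and dec: "base_polytope_decomposition L (map N [1..<s + 1] @ [N' s])"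
    using seq unfolding admits_hyperplane_split_sequence_def hyperplane_split_sequence_def by blast
  \<comment> \<open>Splitting keeps the ground set, so the ground set of each remainder \<open>N' k\<close> stays disjoint
      from that of \<open>K\<close> and its next split can be transferred as well.\<close>
  have N': "matroid (N' k) \<and> ground (N' k) = ground L" if "1 \<le> k" "k \<le> s" for k
    using that
  proof (induction k rule: dec_induct)
    case base
    then show ?case using hyperplane_split_right_piece[OF first] by simp
  next
    case (step k)
    then have "hyperplane_split (N' k) (N (k + 1)) (N' (k + 1))" by (intro later) simp
    from hyperplane_split_right_piece[OF this] step show ?case by simp
  qed
  let ?S = "\<lambda>X k. direct_sum (X k) K"
  have "hyperplane_split (direct_sum L K) (?S N 1) (?S N' 1)"
    using L K disj first by (rule hyperplane_split_direct_sum)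
  moreover have "hyperplane_split (?S N' k) (?S N (k + 1)) (?S N' (k + 1))" if "k \<in> {1..<s}" for k
    using N'[of k] that K disj later[OF that] by (intro hyperplane_split_direct_sum) auto
  moreover have "base_polytope_decomposition (direct_sum L K) (map (?S N) [1..<s + 1] @ [?S N' s])"
    using decomposition_direct_sum[OF L K disj dec] by (simp add: comp_def)
  ultimately have "hyperplane_split_sequence s (direct_sum L K) (?S N) (?S N')"
    unfolding hyperplane_split_sequence_def by blast
  then show ?thesis using s unfolding admits_hyperplane_split_sequence_def by blast
qed

theorem theorem4:
  fixes M1 M2 :: "('a::finite) basis_system" and E1 E2 :: "'a set" and r1 r2 :: nat
  assumes "matroid M1" and "ground M1 = E1" and "matroid_rank M1 = r1"
    and "matroid M2" and "ground M2 = E2" and "matroid_rank M2 = r2"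
    and "E1 \<inter> E2 = {}"
    and "admits_hyperplane_split_sequence M1 \<or> admits_hyperplane_split_sequence M2"
  shows "admits_hyperplane_split_sequence (direct_sum M1 M2)"
  using assms(8)
proof
  assume "admits_hyperplane_split_sequence M1"
  with assms show ?thesis by (intro admits_hyperplane_split_sequence_direct_sum) auto
next
  assume "admits_hyperplane_split_sequence M2"
  with assms have "admits_hyperplane_split_sequence (direct_sum M2 M1)"
    by (intro admits_hyperplane_split_sequence_direct_sum) auto
  then show ?thesis by (subst direct_sum_commute)
qed

end
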